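(* Let $S$ be the set of all similarity-invariant points of the body $p:W_n\to\mathbb{R}^n$, regarded as a convex subset of the real vector space of continuous mappings $W_n\to\mathbb{R}^n$ with pointwise operations. Then $S$ is not the convex hull of finitely many of its elements; that is, there do not exist $m\ge 1$ and $p_1,\dots,p_m\in S$ such that $S=\operatorname{conv}\{p_1,\dots,p_m\}$.
   Context: $\mathbb{R}^n$ is the standard $n$-dimensional real vector space. $W_n$ denotes the set of all compact convex subsets of $\mathbb{R}^n$ with non-empty interior (called convex bodies), equipped with the topology of the Hausdorff metric. Let $\Pi$ be the group of all similarity transformations of $\mathbb{R}^n$, i.e. the group of affine transformations generated by all shifts (translations) and by the invertible linear transformations of $\mathbb{R}^n$ preserving orthogonality. A similarity-invariant point of the body is a continuous mapping $p:W_n\to\mathbb{R}^n$ such that $p(A(K))=A(p(K))$ for all $K\in W_n$ and all $A\in\Pi$, and $p(K)\in K$ for all $K\in W_n$.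
   Formalization: The formal theorem assumes n ≥ 2; for n = 1 the claim is false, because reflecting an interval in its midpoint is a similarity, so the midpoint is the only similarity-invariant point and S = conv{p_1}. *)

theory Defs
  imports
    "HOL-Analysis.Analysis"
    "HOL-Library.Function_Algebras"
    "HOL-Algebra.Bij"
    "HOL-Algebra.Generated_Groups"
begin

section \<open>Functions into a real vector space\<close>

instantiation "fun" :: (type, real_vector) real_vector
begin

definition scaleR_fun :: "real \<Rightarrow> ('a \<Rightarrow> 'b) \<Rightarrow> 'a \<Rightarrow> 'b"
  where "scaleR_fun r f = (\<lambda>x. r *\<^sub>R f x)"

instance
  by standard (auto simp: scaleR_fun_def fun_eq_iff scaleR_add_right scaleR_add_left)

end

lemma scaleR_fun_apply [simp]: "(r *\<^sub>R f) x = r *\<^sub>R f x"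
  by (simp add: scaleR_fun_def)


section \<open>The Hausdorff distance\<close>

text \<open>Meaningful for non-empty bounded sets; only used for convex bodies.\<close>

definition hausdorff_dist :: "'a::metric_space set \<Rightarrow> 'a set \<Rightarrow> real"
  where "hausdorff_dist K L = max (SUP x\<in>K. infdist x L) (SUP y\<in>L. infdist y K)"

lemma bdd_above_infdist_image:
  assumes "compact K"
  shows "bdd_above ((\<lambda>x. infdist x L) ` K)"
proof -
  have "compact ((\<lambda>x. infdist x L) ` K)"
    by (intro compact_continuous_image continuous_intros assms)
  then show ?thesis
    by (intro bounded_imp_bdd_above compact_imp_bounded)
qed

lemma infdist_le_hausdorff_dist:
  assumes "compact K" "x \<in> K"
  shows "infdist x L \<le> hausdorff_dist K L"
  unfolding hausdorff_dist_def
  by (intro max.coboundedI1 cSUP_upper bdd_above_infdist_image assms)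

lemma hausdorff_dist_commute: "hausdorff_dist K L = hausdorff_dist L K"
  by (simp add: hausdorff_dist_def max.commute)

lemma hausdorff_dist_eq_0_iff:
  assumes "compact K" "K \<noteq> {}" "compact L" "L \<noteq> {}"
  shows "hausdorff_dist K L = 0 \<longleftrightarrow> K = L"
proof
  have sub: "A \<subseteq> B"
    if "hausdorff_dist A B = 0" "compact A" "compact B" "B \<noteq> {}" for A B :: "'a set"
  proof
    fix x assume "x \<in> A"
    then have "infdist x B = 0"
      using infdist_le_hausdorff_dist[of A x B] that infdist_nonneg[of x B] by auto
    then show "x \<in> B"
      using that in_closed_iff_infdist_zero compact_imp_closed by blast
  qed
  show "K = L" if "hausdorff_dist K L = 0"
    using sub[of K L] sub[of L K] that assms hausdorff_dist_commute[of K L] by auto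
  show "hausdorff_dist K L = 0" if "K = L"
    using that assms by (simp add: hausdorff_dist_def)
qed

lemma hausdorff_dist_triangle:
  fixes K L M :: "'a::heine_borel set"
  assumes "compact K" "K \<noteq> {}" "compact L" "L \<noteq> {}" "compact M" "M \<noteq> {}"
  shows "hausdorff_dist K M \<le> hausdorff_dist K L + hausdorff_dist L M"
proof -
  have one: "(SUP x\<in>A. infdist x C) \<le> hausdorff_dist A B + hausdorff_dist B C"
    if ne: "compact A" "A \<noteq> {}" "compact B" "B \<noteq> {}" for A B C :: "'a set"
  proof (intro cSUP_least ne)
    fix x assume x: "x \<in> A"
    obtain y where y: "y \<in> B" "infdist x B = dist x y"
      using infdist_attains_inf[OF compact_imp_closed[OF ne(3)] ne(4)] by blast
    have "infdist x C \<le> infdist y C + dist x y"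
      by (rule infdist_triangle)
    also have "\<dots> \<le> hausdorff_dist B C + hausdorff_dist A B"
      using infdist_le_hausdorff_dist[of B y C] infdist_le_hausdorff_dist[of A x B] ne x y by auto
    finally show "infdist x C \<le> hausdorff_dist A B + hausdorff_dist B C"
      by simp
  qed
  show ?thesis
    using one[of K L M] one[of M L K] assms
    by (simp add: hausdorff_dist_def[of K M] hausdorff_dist_commute[of M L]
        hausdorff_dist_commute[of L K])
qed


section \<open>Convex bodies with the Hausdorff metric\<close>

typedef (overloaded) 'n convex_body =
  "{K :: (real ^ 'n::finite) set. compact K \<and> convex K \<and> interior K \<noteq> {}}"
  morphisms body_set Body
proof
  show "cball 0 1 \<in> {K :: (real ^ 'n::finite) set. compact K \<and> convex K \<and> interior K \<noteq> {}}"
    by simp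
qed

lemma compact_body_set: "compact (body_set K)"
  and convex_body_set: "convex (body_set K)"
  and interior_body_set: "interior (body_set K) \<noteq> {}"
  and body_set_nonempty: "body_set K \<noteq> {}"
  using body_set[of K] by auto

instantiation convex_body :: (finite) metric_space
begin

definition dist_convex_body :: "'a convex_body \<Rightarrow> 'a convex_body \<Rightarrow> real"
  where "dist K L = hausdorff_dist (body_set K) (body_set L)"

definition uniformity_convex_body :: "('a convex_body \<times> 'a convex_body) filter"
  where "uniformity_convex_body = (INF e\<in>{0<..}. principal {(K, L). dist K L < e})"

definition open_convex_body :: "'a convex_body set \<Rightarrow> bool"
  where "open_convex_body U \<longleftrightarrow>
    (\<forall>K\<in>U. eventually (\<lambda>(K', L). K' = K \<longrightarrow> L \<in> U) uniformity)"

instance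
proof
  fix K L M :: "'a convex_body"
  show "dist K L = 0 \<longleftrightarrow> K = L"
    by (simp add: dist_convex_body_def hausdorff_dist_eq_0_iff compact_body_set
        body_set_nonempty body_set_inject)
  show "dist K L \<le> dist K M + dist L M"
    unfolding dist_convex_body_def hausdorff_dist_commute[of "body_set L" "body_set M"]
    by (intro hausdorff_dist_triangle compact_body_set body_set_nonempty)
qed (simp_all add: uniformity_convex_body_def open_convex_body_def)

end


section \<open>Similarity transformations\<close>

definition shifts :: "(real ^ 'n \<Rightarrow> real ^ 'n) set"
  where "shifts = {A. \<exists>b. A = (\<lambda>x. x + b)}"

definition orthogonality_preserving_maps :: "(real ^ 'n \<Rightarrow> real ^ 'n) set"
  where "orthogonality_preserving_maps =
    {A. linear A \<and> bij A \<and> (\<forall>x y. orthogonal x y \<longrightarrow> orthogonal (A x) (A y))}"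

text \<open>The subgroup generated by these maps in the group of all bijections of the space.\<close>

definition similarities :: "(real ^ 'n \<Rightarrow> real ^ 'n) set"
  where "similarities = generate (BijGroup UNIV) (shifts \<union> orthogonality_preserving_maps)"

text \<open>Junk value unless the image is again a convex body; see \<open>body_set_image_body\<close> below.\<close>

definition image_body :: "(real ^ 'n \<Rightarrow> real ^ 'n) \<Rightarrow> 'n convex_body \<Rightarrow> 'n convex_body"
  where "image_body A K = Body (A ` body_set K)"

lemma similarity_affine_bij:
  assumes "A \<in> similarities"
  shows "bij A \<and> (\<exists>f b. linear f \<and> A = (\<lambda>x. f x + b))"
  using assms unfolding similarities_def
proof (induction rule: generate.induct)
  case one
  show ?case
    using linear_id by (auto simp: BijGroup_def restrict_def id_def fun_eq_iff
        intro!: bij_id[unfolded id_def] exI[of _ "\<lambda>x. x"])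
next
  case (incl h)
  then show ?case
  proof
    assume "h \<in> shifts"
    then obtain b where "h = (\<lambda>x. x + b)"
      by (auto simp: shifts_def)
    moreover have "bij (\<lambda>x. x + b)"
      by (rule o_bij[of "\<lambda>x. x - b"]) (auto simp: fun_eq_iff)
    ultimately show ?thesis
      by (auto intro!: exI[of _ id] exI[of _ b] simp: linear_id)
  next
    assume "h \<in> orthogonality_preserving_maps"
    then show ?thesis
      by (auto simp: orthogonality_preserving_maps_def intro!: exI[of _ h] exI[of _ "0 :: real ^ 'a"])
  qed
next
  case (inv h)
  have eq: "inv\<^bsub>BijGroup UNIV\<^esub> g = inv_into UNIV g"
    if "bij g" for g :: "real ^ 'a \<Rightarrow> real ^ 'a"
    using inv_BijGroup[of g UNIV] that by (simp add: Bij_def restrict_def)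
  from inv show ?case
  proof
    assume "h \<in> shifts"
    then obtain b where h: "h = (\<lambda>x. x + b)"
      by (auto simp: shifts_def)
    have bij: "bij h"
      unfolding h by (rule o_bij[of "\<lambda>x. x - b"]) (auto simp: fun_eq_iff)
    have "inv_into UNIV h = (\<lambda>x. x - b)"
      by (rule inv_unique_comp) (auto simp: h fun_eq_iff)
    then show ?thesis
      using bij_imp_bij_inv[OF bij]
      by (auto simp: eq[OF bij] intro!: exI[of _ id] exI[of _ "- b"] simp: linear_id)
  next
    assume "h \<in> orthogonality_preserving_maps"
    then have h: "linear h" "bij h"
      by (auto simp: orthogonality_preserving_maps_def)
    then have "linear (inv_into UNIV h)"
      by (metis bij_def inj_linear_imp_inv_linear)
    then show ?thesis
      using bij_imp_bij_inv[OF h(2)]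
      by (auto simp: eq[OF h(2)] intro!: exI[of _ "inv_into UNIV h"]
          exI[of _ "0 :: real ^ 'a"])
  qed
next
  case (eng g h)
  then obtain f1 b1 f2 b2 where fb: "linear f1" "g = (\<lambda>x. f1 x + b1)" "linear f2"
    "h = (\<lambda>x. f2 x + b2)" and bij: "bij g" "bij h"
    by blast
  have eq: "g \<otimes>\<^bsub>BijGroup UNIV\<^esub> h = g \<circ> h"
    using bij by (simp add: BijGroup_def Bij_def compose_def fun_eq_iff)
  have "linear (f1 \<circ> f2)"
    by (rule linear_compose) fact+
  moreover have "g \<circ> h = (\<lambda>x. (f1 \<circ> f2) x + (f1 b2 + b1))"
    using fb by (simp add: fun_eq_iff linear_add)
  ultimately show ?case
    unfolding eq using bij bij_comp by blast
qed

lemma body_set_image_body: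
  assumes "A \<in> similarities"
  shows "body_set (image_body A K) = A ` body_set K"
proof -
  obtain f b where f: "linear f" "A = (\<lambda>x. f x + b)" and "bij A"
    using similarity_affine_bij[OF assms] by blast
  have "inj f"
    using \<open>bij A\<close> f by (auto simp: bij_def inj_def)
  have eq: "A ` S = (+) b ` f ` S" for S
    by (auto simp: f image_image add.commute)
  have "compact (A ` body_set K)" "convex (A ` body_set K)"
    unfolding eq using f(1)
    by (auto intro!: compact_translation compact_continuous_image linear_continuous_on
        compact_body_set convex_translation convex_linear_image convex_body_set
        simp: linear_conv_bounded_linear)
  moreover have "interior (A ` body_set K) \<noteq> {}"
    unfolding eq interior_translation
    using interior_injective_linear_image[OF f(1) \<open>inj f\<close>] interior_body_set by auto
  ultimately show ?thesis
    by (simp add: image_body_def Body_inverse)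
qed


section \<open>Similarity-invariant points of the body\<close>

text \<open>A convex hull formed in the space of all functions agrees with the one formed in its
  subspace of continuous functions.\<close>

definition similarity_invariant_points_of_body :: "('n::finite convex_body \<Rightarrow> real ^ 'n) set"
  where "similarity_invariant_points_of_body =
    {p. continuous_on UNIV p
      \<and> (\<forall>K. \<forall>A\<in>similarities. p (image_body A K) = A (p K))
      \<and> (\<forall>K. p K \<in> body_set K)}"

end

theory Submission
  imports Defs
begin

text \<open>
  Let \<open>p\<close> be the Chebyshev centre, which minimises \<open>sup {|x - c|\<^sup>2 | x \<in> K}\<close> over \<open>c\<close>, and let \<open>q\<close>
  minimise \<open>sup {|x - c|\<^sup>2 + f K x | x \<in> K}\<close>, where \<open>f K x\<close> is the squared distance from \<open>K\<close> of the
  reflection of \<open>x\<close> in \<open>p K\<close>. Strong convexity in \<open>c\<close> makes the minimisers unique and continuous in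
  \<open>K\<close>, so \<open>p\<close> and \<open>q\<close> are invariant points. The ratio \<open>w = |q - p| / diam\<close> is a continuous
  similarity-invariant function with values in \<open>[0, 1]\<close>, hence \<open>p + w^k (q - p)\<close> is an invariant
  point for every \<open>k\<close>. A linear relation between the maps \<open>w^k (q - p)\<close> is a polynomial vanishing
  at all non-zero values of \<open>w\<close>. These are infinite in number: cutting the unit ball by a moving
  half-space, \<open>w\<close> varies continuously from a positive value at the half-ball, where \<open>p = 0 \<noteq> q\<close>, to
  \<open>0\<close> at the full ball. So the invariant points do not lie in a finite-dimensional subspace.
\<close>

section \<open>Weighted Chebyshev centres\<close>

text \<open>For \<open>f = 0\<close> and compact nonempty \<open>K\<close> this is the squared
  radius of the smallest ball about \<open>c\<close> containing \<open>K\<close>. Squaring the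
  distance is what makes the function strongly convex in \<open>c\<close>.\<close>

definition weighted_sqdist :: "'a::metric_space set \<Rightarrow> ('a \<Rightarrow> real) \<Rightarrow> 'a \<Rightarrow> real"
  where "weighted_sqdist K f c = (SUP x\<in>K. (dist x c)\<^sup>2 + f x)"

lemma weighted_sqdist_upper:
  assumes "compact K" "continuous_on K f" "x \<in> K"
  shows "(dist x c)\<^sup>2 + f x \<le> weighted_sqdist K f c"
  unfolding weighted_sqdist_def
proof (rule cSUP_upper[OF \<open>x \<in> K\<close>])
  have "compact ((\<lambda>x. (dist x c)\<^sup>2 + f x) ` K)"
    by (intro compact_continuous_image continuous_intros assms)
  then show "bdd_above ((\<lambda>x. (dist x c)\<^sup>2 + f x) ` K)"
    by (intro bounded_imp_bdd_above compact_imp_bounded)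
qed

lemma weighted_sqdist_least:
  assumes "K \<noteq> {}" "\<And>x. x \<in> K \<Longrightarrow> (dist x c)\<^sup>2 + f x \<le> B"
  shows "weighted_sqdist K f c \<le> B"
  unfolding weighted_sqdist_def using assms by (rule cSUP_least)

text \<open>Rests on (t + h)^2 - t^2 = h (2 t + h) with t <= \<open>D\<close>. Set and centre may
  both change, so one estimate serves continuity in the centre for a fixed set and continuity in the
  body for a fixed centre.\<close>

lemma weighted_sqdist_perturb:
  assumes "K \<noteq> {}" "compact L" "continuous_on L g" "0 \<le> h"
    and near: "\<And>x. x \<in> K \<Longrightarrow> \<exists>y\<in>L. dist x c \<le> dist y d + h \<and> dist y d \<le> D \<and> f x \<le> g y + e"
  shows "weighted_sqdist K f c \<le> weighted_sqdist L g d + h * (2 * D + h) + e"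
proof (rule weighted_sqdist_least[OF \<open>K \<noteq> {}\<close>])
  fix x assume "x \<in> K"
  then obtain y where y: "y \<in> L" "dist x c \<le> dist y d + h" "dist y d \<le> D" "f x \<le> g y + e"
    using near by blast
  have "(dist x c)\<^sup>2 \<le> (dist y d + h)\<^sup>2"
    using y(2) by (intro power_mono) auto
  also have "\<dots> = (dist y d)\<^sup>2 + h * (2 * dist y d + h)"
    by (simp add: power2_eq_square algebra_simps)
  also have "\<dots> \<le> (dist y d)\<^sup>2 + h * (2 * D + h)"
    using y(3) \<open>0 \<le> h\<close> by (intro add_left_mono mult_left_mono) auto
  finally show "(dist x c)\<^sup>2 + f x \<le> weighted_sqdist L g d + h * (2 * D + h) + e"
    using weighted_sqdist_upper[OF assms(2,3) y(1), of d] y(4) by linarith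
qed

text \<open>By the median formula the estimate holds for each \<open>x\<close> separately. Its last
  term does not depend on \<open>x\<close> and so survives the supremum.\<close>

lemma weighted_sqdist_midpoint:
  fixes K :: "'a::real_inner set"
  assumes "compact K" "K \<noteq> {}" "continuous_on K f"
  shows "weighted_sqdist K f (midpoint a b) \<le>
    (weighted_sqdist K f a + weighted_sqdist K f b) / 2 - (dist a b)\<^sup>2 / 4"
proof (rule weighted_sqdist_least[OF \<open>K \<noteq> {}\<close>])
  fix x assume x: "x \<in> K"
  have "(dist x (midpoint a b))\<^sup>2 = ((dist x a)\<^sup>2 + (dist x b)\<^sup>2) / 2 - (dist a b)\<^sup>2 / 4"
    unfolding dist_norm midpoint_def power2_norm_eq_inner
    by (simp add: inner_simps inner_commute field_simps)
  then show "(dist x (midpoint a b))\<^sup>2 + f x \<le>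
      (weighted_sqdist K f a + weighted_sqdist K f b) / 2 - (dist a b)\<^sup>2 / 4"
    using weighted_sqdist_upper[OF assms(1,3) x, of a] weighted_sqdist_upper[OF assms(1,3) x, of b]
    by (simp add: field_simps)
qed

text \<open>Testing minimality at the midpoint of \<open>d\<close> and \<open>c\<close> shows that
  near-minimisers are near \<open>c\<close>. Uniqueness and continuity of the centre both come from
  this.\<close>

lemma weighted_sqdist_gap:
  fixes K :: "'a::real_inner set"
  assumes "compact K" "K \<noteq> {}" "continuous_on K f"
    and min: "\<And>d. weighted_sqdist K f c \<le> weighted_sqdist K f d"
  shows "(dist d c)\<^sup>2 \<le> 2 * (weighted_sqdist K f d - weighted_sqdist K f c)"
  using weighted_sqdist_midpoint[OF assms(1-3), of d c] min[of "midpoint d c"]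
  by (simp add: field_simps)

text \<open>On \<open>K\<close> all distances are at most the diameter, so the perturbation estimate
  yields a Lipschitz constant. Continuity on \<open>K\<close> is enough to obtain a minimum over
  \<open>K\<close>.\<close>

lemma continuous_on_weighted_sqdist:
  fixes K :: "'a::real_inner set"
  assumes "compact K" "K \<noteq> {}" "continuous_on K f"
  shows "continuous_on K (weighted_sqdist K f)"
proof -
  have *: "weighted_sqdist K f c \<le> weighted_sqdist K f d + dist c d * (3 * diameter K)"
    if "c \<in> K" "d \<in> K" for c d
  proof -
    have diam: "dist x y \<le> diameter K" if "x \<in> K" "y \<in> K" for x y
      using diameter_bounded_bound[OF compact_imp_bounded[OF assms(1)]] that by blast
    have "weighted_sqdist K f c \<le>
        weighted_sqdist K f d + dist c d * (2 * diameter K + dist c d) + 0"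
    proof (rule weighted_sqdist_perturb)
      fix x assume "x \<in> K"
      with that diam show "\<exists>y\<in>K. dist x c \<le> dist y d + dist c d \<and> dist y d \<le> diameter K \<and> f x \<le> f y + 0"
        by (intro bexI[of _ x]) (auto simp: dist_triangle3 dist_commute dist_triangle add.commute)
    qed (use assms in auto)
    also have "\<dots> \<le> weighted_sqdist K f d + dist c d * (3 * diameter K)"
      using diam[OF that] by (simp add: mult_left_mono)
    finally show ?thesis .
  qed
  have "(3 * diameter K)-lipschitz_on K (weighted_sqdist K f)"
  proof (rule lipschitz_onI)
    fix c d assume "c \<in> K" "d \<in> K"
    with *[of c d] *[of d c]
    show "dist (weighted_sqdist K f c) (weighted_sqdist K f d) \<le> 3 * diameter K * dist c d"
      by (simp add: dist_real_def abs_le_iff dist_commute mult.commute)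
  qed (use diameter_ge_0[OF compact_imp_bounded[OF assms(1)]] in simp)
  then show ?thesis
    by (rule lipschitz_on_continuous_on)
qed

section \<open>Existence and uniqueness of the minimiser\<close>

definition weighted_center :: "'a::metric_space set \<Rightarrow> ('a \<Rightarrow> real) \<Rightarrow> 'a"
  where "weighted_center K f = (THE c. \<forall>d. weighted_sqdist K f c \<le> weighted_sqdist K f d)"

lemma weighted_center_eqI:
  fixes K :: "'a::real_inner set"
  assumes "compact K" "K \<noteq> {}" "continuous_on K f"
    and min: "\<And>d. weighted_sqdist K f c \<le> weighted_sqdist K f d"
  shows "weighted_center K f = c"
  unfolding weighted_center_def
proof (rule the_equality)
  fix d assume "\<forall>c. weighted_sqdist K f d \<le> weighted_sqdist K f c"
  then have "(dist d c)\<^sup>2 \<le> 0"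
    using weighted_sqdist_gap[OF assms, of d] min[of d] by (smt (verit))
  then show "d = c" by simp
qed (use min in auto)

text \<open>Compactness gives a minimiser over \<open>K\<close>. Projecting to the convex set
  \<open>K\<close> does not increase distances to points of \<open>K\<close>, so it is a minimiser
  over the whole space. Global minimality is needed to test the functional of one body at the centre
  of another.\<close>

lemma weighted_center:
  fixes K :: "'a::euclidean_space set"
  assumes "compact K" "convex K" "K \<noteq> {}" "continuous_on K f"
  shows weighted_center_in: "weighted_center K f \<in> K"
    and weighted_center_le: "weighted_sqdist K f (weighted_center K f) \<le> weighted_sqdist K f d"
proof -
  obtain c where c: "c \<in> K" "\<And>d. d \<in> K \<Longrightarrow> weighted_sqdist K f c \<le> weighted_sqdist K f d"
    using continuous_attains_inf[OF assms(1,3) continuous_on_weighted_sqdist] assms by metis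
  have "weighted_sqdist K f c \<le> weighted_sqdist K f d" for d
  proof -
    let ?d = "closest_point K d"
    have cl: "closed K" using assms(1) by (rule compact_imp_closed)
    have "weighted_sqdist K f ?d \<le> weighted_sqdist K f d"
    proof (rule weighted_sqdist_least[OF assms(3)])
      fix x assume x: "x \<in> K"
      have "dist x ?d \<le> dist x d"
        using closest_point_lipschitz[OF assms(2) cl assms(3), of x d] closest_point_self[OF x] by simp
      then have "(dist x ?d)\<^sup>2 \<le> (dist x d)\<^sup>2"
        by (intro power_mono) auto
      then show "(dist x ?d)\<^sup>2 + f x \<le> weighted_sqdist K f d"
        using weighted_sqdist_upper[OF assms(1,4) x, of d] by linarith
    qed
    with c(2)[OF closest_point_in_set[OF cl assms(3)]] show ?thesis
      by (meson order_trans)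
  qed
  with weighted_center_eqI[OF assms(1,3,4)] c(1)
  show "weighted_center K f \<in> K" "weighted_sqdist K f (weighted_center K f) \<le> weighted_sqdist K f d"
    by auto
qed

section \<open>Convex bodies and similarities\<close>

lemma body_near_point:
  assumes "dist K L < d" "x \<in> body_set K"
  obtains y where "y \<in> body_set L" "dist x y < d"
proof -
  obtain y where "y \<in> body_set L" "infdist x (body_set L) = dist x y"
    using infdist_attains_inf[OF compact_imp_closed[OF compact_body_set] body_set_nonempty] by blast
  then show thesis
    using that infdist_le_hausdorff_dist[OF compact_body_set assms(2), of "body_set L"] assms(1)
    by (auto simp: dist_convex_body_def)
qed

lemma dist_convex_body_le:
  assumes "\<And>x. x \<in> body_set K \<Longrightarrow> \<exists>y\<in>body_set L. dist x y \<le> d"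
    and "\<And>y. y \<in> body_set L \<Longrightarrow> \<exists>x\<in>body_set K. dist x y \<le> d"
  shows "dist K L \<le> d"
  unfolding dist_convex_body_def hausdorff_dist_def
proof (intro max.boundedI cSUP_least body_set_nonempty)
  show "infdist x (body_set L) \<le> d" if "x \<in> body_set K" for x
    using assms(1)[OF that] infdist_le2 by blast
  show "infdist y (body_set K) \<le> d" if "y \<in> body_set L" for y
    using assms(2)[OF that] infdist_le2 by (metis dist_commute)
qed

text \<open>Joint Lipschitz dependence on point and body, by the triangle inequality through a
  nearest point of \<open>L\<close>. The slack \<open>e\<close> is there because
  \<open>body_near_point\<close> wants a strict bound.\<close>

lemma infdist_body_le:
  "infdist x (body_set K) \<le> infdist y (body_set L) + dist x y + dist K L"
proof (rule field_le_epsilon)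
  fix e :: real assume "e > 0"
  obtain z where z: "z \<in> body_set L" "infdist y (body_set L) = dist y z"
    using infdist_attains_inf[OF compact_imp_closed[OF compact_body_set] body_set_nonempty] by blast
  obtain z' where z': "z' \<in> body_set K" "dist z z' < dist K L + e"
    using body_near_point[of L K "dist K L + e" z] z \<open>e > 0\<close> by (auto simp: dist_commute)
  have "infdist x (body_set K) \<le> dist x z'"
    using z'(1) by (rule infdist_le)
  then show "infdist x (body_set K) \<le> infdist y (body_set L) + dist x y + dist K L + e"
    using z(2) z'(2) dist_triangle[of x z' y] dist_triangle[of y z' z] by linarith
qed

lemma dist_le_diameter_body:
  "x \<in> body_set K \<Longrightarrow> y \<in> body_set K \<Longrightarrow> dist x y \<le> diameter (body_set K)"
  using diameter_bounded_bound[OF compact_imp_bounded[OF compact_body_set]] by blast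

text \<open>The interior contains a ball, hence two distinct points of the body. This makes division
  by the diameter legitimate later.\<close>

lemma diameter_body_pos: "diameter (body_set K) > 0"
proof -
  obtain x e where "e > 0" "cball x e \<subseteq> body_set K"
    using interior_body_set[of K] by (metis all_not_in_conv mem_interior_cball)
  moreover obtain b :: "real ^ 'a" where "b \<in> Basis"
    using nonempty_Basis by blast
  ultimately have "dist x (x + e *\<^sub>R b) \<le> diameter (body_set K)"
    by (intro dist_le_diameter_body) (auto simp: dist_norm)
  then show ?thesis
    using \<open>e > 0\<close> \<open>b \<in> Basis\<close> by (simp add: dist_norm)
qed

lemma diameter_body_le: "diameter (body_set K) \<le> diameter (body_set L) + 2 * dist K L"
proof (rule field_le_epsilon)
  fix e :: real assume "e > 0"
  show "diameter (body_set K) \<le> diameter (body_set L) + 2 * dist K L + e"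
  proof (rule diameter_le)
    fix x y assume "x \<in> body_set K" "y \<in> body_set K"
    then obtain x' y' where "x' \<in> body_set L" "y' \<in> body_set L"
      "dist x x' < dist K L + e / 2" "dist y y' < dist K L + e / 2"
      using body_near_point[of K L "dist K L + e / 2"] \<open>e > 0\<close>
      by (metis less_add_same_cancel1 half_gt_zero)
    moreover have "dist x y \<le> dist x x' + dist x' y' + dist y y'"
      using dist_triangle[of x y x'] dist_triangle[of x' y y'] by (simp add: dist_commute)
    ultimately show "norm (x - y) \<le> diameter (body_set L) + 2 * dist K L + e"
      using dist_le_diameter_body[of x' L y'] by (simp add: dist_norm)
  qed (use body_set_nonempty in blast)
qed

lemma continuous_on_diameter_body: "continuous_on UNIV (\<lambda>K :: 'n::finite convex_body. diameter (body_set K))"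
proof (rule lipschitz_on_continuous_on)
  show "2-lipschitz_on UNIV (\<lambda>K :: 'n convex_body. diameter (body_set K))"
  proof (rule lipschitz_onI)
    fix K L :: "'n convex_body"
    show "dist (diameter (body_set K)) (diameter (body_set L)) \<le> 2 * dist K L"
      using diameter_body_le[of K L] diameter_body_le[of L K]
      by (simp add: dist_real_def abs_le_iff dist_commute)
  qed simp
qed

text \<open>Equal norms of \<open>x\<close> and \<open>y\<close> mean that \<open>x + y\<close> and
  \<open>x - y\<close> are orthogonal, so a linear map preserving orthogonality also preserves
  equality of norms. The factor \<open>s\<close> is then the norm of the image of any unit
  vector.\<close>

lemma orthogonality_preserving_norm:
  assumes "A \<in> orthogonality_preserving_maps"
  obtains s where "s > 0" "\<And>x. norm (A x) = s * norm x"
proof -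
  have lin: "linear A" and bij: "bij A" and orth: "\<And>x y. orthogonal x y \<Longrightarrow> orthogonal (A x) (A y)"
    using assms by (auto simp: orthogonality_preserving_maps_def)
  have eq: "norm (A x) = norm (A y)" if "norm x = norm y" for x y
  proof -
    have "orthogonal (x + y) (x - y)"
      using that by (simp add: orthogonal_def inner_simps inner_commute norm_eq)
    from orth[OF this] show ?thesis
      by (simp add: orthogonal_def linear_add[OF lin] linear_diff[OF lin] inner_simps inner_commute
          norm_eq)
  qed
  obtain b :: "real ^ 'a" where b: "norm b = 1"
    using vector_choose_size[of 1] by auto
  show thesis
  proof
    have "A b \<noteq> A 0"
      using bij b by (metis bij_pointE norm_zero zero_neq_one)
    then show "norm (A b) > 0"
      by (simp add: linear_0[OF lin])
    show "norm (A x) = norm (A b) * norm x" for x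
      using eq[of x "norm x *\<^sub>R b"] b by (simp add: linear_cmul[OF lin])
  qed
qed

text \<open>Induction over the generated group: each generator scales all distances by one factor,
  inverses invert the factor, products multiply the factors.\<close>

lemma similarity_dist:
  assumes "A \<in> similarities"
  obtains s where "s > 0" "\<And>x y. dist (A x) (A y) = s * dist x y"
proof -
  \<comment> \<open>Bijectivity is carried along because the group inverse in
    \<open>BijGroup\<close> is identified with \<open>inv_into\<close> only for bijections.\<close>
  have gen: "bij h \<and> (\<exists>s>0. \<forall>x y. dist (h x) (h y) = s * dist x y)"
    if "h \<in> shifts \<union> orthogonality_preserving_maps" for h :: "real ^ 'a \<Rightarrow> real ^ 'a"
  proof (rule conjI)
    show "bij h"
      using that generate.incl[of h _ "BijGroup UNIV"] similarity_affine_bij[of h]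
      unfolding similarities_def by blast
    from that show "\<exists>s>0. \<forall>x y. dist (h x) (h y) = s * dist x y"
    proof
      assume "h \<in> shifts"
      then show ?thesis
        by (intro exI[of _ 1]) (auto simp: shifts_def)
    next
      assume h: "h \<in> orthogonality_preserving_maps"
      then have "linear h"
        by (simp add: orthogonality_preserving_maps_def)
      moreover obtain s where "s > 0" "\<And>x. norm (h x) = s * norm x"
        using orthogonality_preserving_norm[OF h] by blast
      ultimately show ?thesis
        by (intro exI[of _ s]) (simp add: dist_norm flip: linear_diff)
    qed
  qed
  have "\<exists>s>0. \<forall>x y. dist (A x) (A y) = s * dist x y"
    using assms unfolding similarities_def
  proof (induction rule: generate.induct)
    case one
    then show ?case
      by (intro exI[of _ 1]) (auto simp: BijGroup_def)
  next
    case (incl h)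
    with gen show ?case by blast
  next
    case (inv h)
    from gen[OF this] obtain s where bij: "bij h" and s: "s > 0" "\<And>x y. dist (h x) (h y) = s * dist x y"
      by blast
    have eq: "inv\<^bsub>BijGroup UNIV\<^esub> h = inv_into UNIV h"
      using inv_BijGroup[of h UNIV] bij by (simp add: Bij_def restrict_def)
    have "dist (inv_into UNIV h x) (inv_into UNIV h y) = 1 / s * dist x y" for x y
      using s(2)[of "inv_into UNIV h x" "inv_into UNIV h y"] s(1) bij
      by (simp add: bij_is_surj surj_f_inv_f)
    then show ?case
      unfolding eq using s(1) by (intro exI[of _ "1 / s"]) auto
  next
    case (eng g h)
    then have "bij g" "bij h"
      using similarity_affine_bij unfolding similarities_def by blast+
    then have eq: "g \<otimes>\<^bsub>BijGroup UNIV\<^esub> h = g \<circ> h"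
      by (simp add: BijGroup_def Bij_def compose_def fun_eq_iff)
    from eng.IH obtain s t where "s > 0" "\<And>x y. dist (g x) (g y) = s * dist x y"
      "t > 0" "\<And>x y. dist (h x) (h y) = t * dist x y"
      by blast
    then show ?case
      unfolding eq by (intro exI[of _ "s * t"]) auto
  qed
  with that show thesis by blast
qed

text \<open>A weight scaling by the square of \<open>s\<close> behaves like the squared distance, so
  the whole functional is multiplied by one constant and minimisers are carried to
  minimisers.\<close>

lemma weighted_sqdist_image:
  assumes K: "compact K" "K \<noteq> {}" "continuous_on K f"
    and AK: "compact (A ` K)" "continuous_on (A ` K) g"
    and s: "s > 0" and dist: "\<And>x y. dist (A x) (A y) = s * dist x y"
    and g: "\<And>x. x \<in> K \<Longrightarrow> g (A x) = s\<^sup>2 * f x"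
  shows "weighted_sqdist (A ` K) g (A c) = s\<^sup>2 * weighted_sqdist K f c"
proof (rule antisym)
  have eq: "(dist (A x) (A c))\<^sup>2 + g (A x) = s\<^sup>2 * ((dist x c)\<^sup>2 + f x)" if "x \<in> K" for x
    by (simp add: dist g[OF that] power_mult_distrib distrib_left)
  show "weighted_sqdist (A ` K) g (A c) \<le> s\<^sup>2 * weighted_sqdist K f c"
  proof (rule weighted_sqdist_least)
    fix y assume "y \<in> A ` K"
    then obtain x where x: "x \<in> K" "y = A x" by blast
    show "(dist y (A c))\<^sup>2 + g y \<le> s\<^sup>2 * weighted_sqdist K f c"
      unfolding x(2) eq[OF x(1)] by (intro mult_left_mono weighted_sqdist_upper K x) auto
  qed (use K in simp)
  have "weighted_sqdist K f c \<le> weighted_sqdist (A ` K) g (A c) / s\<^sup>2"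
  proof (rule weighted_sqdist_least[OF K(2)])
    fix x assume x: "x \<in> K"
    have "s\<^sup>2 * ((dist x c)\<^sup>2 + f x) \<le> weighted_sqdist (A ` K) g (A c)"
      unfolding eq[OF x, symmetric] using x by (intro weighted_sqdist_upper AK) auto
    with s show "(dist x c)\<^sup>2 + f x \<le> weighted_sqdist (A ` K) g (A c) / s\<^sup>2"
      by (simp add: pos_le_divide_eq mult.commute)
  qed
  with s show "s\<^sup>2 * weighted_sqdist K f c \<le> weighted_sqdist (A ` K) g (A c)"
    by (simp add: pos_le_divide_eq mult.commute)
qed

lemma infdist_image_body:
  assumes "A \<in> similarities" "s > 0" "\<And>x y. dist (A x) (A y) = s * dist x y"
  shows "infdist (A z) (body_set (image_body A K)) = s * infdist z (body_set K)"
proof (rule antisym)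
  obtain y where y: "y \<in> body_set K" "infdist z (body_set K) = dist z y"
    using infdist_attains_inf[OF compact_imp_closed[OF compact_body_set] body_set_nonempty] by blast
  then have "infdist (A z) (A ` body_set K) \<le> dist (A z) (A y)"
    by (intro infdist_le) auto
  then show "infdist (A z) (body_set (image_body A K)) \<le> s * infdist z (body_set K)"
    using y(2) assms(3) by (simp add: body_set_image_body[OF assms(1)])
  obtain y' where y': "y' \<in> body_set (image_body A K)"
    "infdist (A z) (body_set (image_body A K)) = dist (A z) y'"
    using infdist_attains_inf[OF compact_imp_closed[OF compact_body_set] body_set_nonempty] by blast
  then obtain x where "x \<in> body_set K" "y' = A x"
    by (auto simp: body_set_image_body[OF assms(1)])
  then show "s * infdist z (body_set K) \<le> infdist (A z) (body_set (image_body A K))"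
    using y'(2) assms(2,3) by (simp add: infdist_le)
qed

lemma diameter_image_body:
  assumes "A \<in> similarities" "s > 0" "\<And>x y. dist (A x) (A y) = s * dist x y"
  shows "diameter (body_set (image_body A K)) = s * diameter (body_set K)"
proof (rule antisym)
  show "diameter (body_set (image_body A K)) \<le> s * diameter (body_set K)"
  proof (rule diameter_le)
    fix x y assume "x \<in> body_set (image_body A K)" "y \<in> body_set (image_body A K)"
    then obtain x' y' where "x' \<in> body_set K" "y' \<in> body_set K" "x = A x'" "y = A y'"
      by (auto simp: body_set_image_body[OF assms(1)])
    then show "norm (x - y) \<le> s * diameter (body_set K)"
      using assms(2,3) dist_le_diameter_body[of x' K y'] by (simp flip: dist_norm)
  qed (simp add: body_set_nonempty)
  have "diameter (body_set K) \<le> diameter (body_set (image_body A K)) / s"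
  proof (rule diameter_le)
    fix x y assume "x \<in> body_set K" "y \<in> body_set K"
    then have "dist (A x) (A y) \<le> diameter (body_set (image_body A K))"
      by (intro dist_le_diameter_body) (auto simp: body_set_image_body[OF assms(1)])
    then show "norm (x - y) \<le> diameter (body_set (image_body A K)) / s"
      using assms(2,3) by (simp add: pos_le_divide_eq mult.commute flip: dist_norm)
  qed (simp add: body_set_nonempty)
  with assms(2) show "s * diameter (body_set K) \<le> diameter (body_set (image_body A K))"
    by (simp add: pos_le_divide_eq mult.commute)
qed

section \<open>Invariant points from weights\<close>

text \<open>The first condition is joint continuity in body and point, uniform over the points of
  \<open>K\<close>; it controls no values outside the bodies. The second gives the weight the
  scaling of a squared distance.\<close>

locale similarity_weight =
  fixes f :: "'n::finite convex_body \<Rightarrow> real ^ 'n \<Rightarrow> real"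
  assumes weight_continuous: "0 < e \<Longrightarrow> \<exists>d>0. \<forall>L x y. dist K L < d \<longrightarrow> x \<in> body_set K \<longrightarrow>
      y \<in> body_set L \<longrightarrow> dist x y < d \<longrightarrow> \<bar>f K x - f L y\<bar> < e"
    and weight_image: "A \<in> similarities \<Longrightarrow> s > 0 \<Longrightarrow> (\<And>x y. dist (A x) (A y) = s * dist x y) \<Longrightarrow>
      x \<in> body_set K \<Longrightarrow> f (image_body A K) (A x) = s\<^sup>2 * f K x"
begin

definition center :: "'n convex_body \<Rightarrow> real ^ 'n"
  where "center K = weighted_center (body_set K) (f K)"

lemma continuous_on_weight: "continuous_on (body_set K) (f K)"
  unfolding continuous_on_iff
proof (intro ballI allI impI)
  fix x and e :: real assume "x \<in> body_set K" "0 < e"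
  then show "\<exists>d>0. \<forall>y\<in>body_set K. dist y x < d \<longrightarrow> dist (f K y) (f K x) < e"
    using weight_continuous[of e K] by (fastforce simp: dist_real_def)
qed

lemma center_le:
  "weighted_sqdist (body_set K) (f K) (center K) \<le> weighted_sqdist (body_set K) (f K) d"
  unfolding center_def
  by (intro weighted_center_le compact_body_set convex_body_set body_set_nonempty
      continuous_on_weight)

lemma center_in: "center K \<in> body_set K"
  unfolding center_def
  by (intro weighted_center_in compact_body_set convex_body_set body_set_nonempty
      continuous_on_weight)

text \<open>The perturbation estimate is applied in both directions with the same \<open>c\<close>.
  Keeping \<open>c\<close> in one of the two bodies bounds all distances, and the centres to be
  compared do lie there.\<close>

lemma weighted_sqdist_body_close:
  assumes "0 < e"
  obtains d where "0 < d" "\<And>L c. dist K L < d \<Longrightarrow> c \<in> body_set K \<union> body_set L \<Longrightarrow>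
    \<bar>weighted_sqdist (body_set K) (f K) c - weighted_sqdist (body_set L) (f L) c\<bar> \<le> e"
proof -
  define r where "r = e / 2"
  have r: "0 < r" "e = 2 * r"
    using assms by (simp_all add: r_def)
  \<comment> \<open>Points of \<open>L\<close> will be within 1 of \<open>K\<close>, so each of the
    two endpoints of a segment adds at most 1 to the diameter.\<close>
  define D where "D = diameter (body_set K) + 2"
  have "D > 0"
    using diameter_body_pos[of K] by (simp add: D_def)
  obtain d0 where d0: "d0 > 0" "\<And>L x y. dist K L < d0 \<Longrightarrow> x \<in> body_set K \<Longrightarrow>
      y \<in> body_set L \<Longrightarrow> dist x y < d0 \<Longrightarrow> \<bar>f K x - f L y\<bar> < r"
    using weight_continuous[of r K] r by auto
  \<comment> \<open>Half of \<open>e\<close> pays for the change of the weight, the other half for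
    the change of the squared distance.\<close>
  define d where "d = min (min d0 1) (r / (2 * D + 1))"
  have d: "0 < d" "d \<le> d0" "d \<le> 1"
    using d0(1) r \<open>D > 0\<close> by (auto simp: d_def)
  have "d \<le> r / (2 * D + 1)"
    by (simp add: d_def)
  then have "d * (2 * D + 1) \<le> r"
    using \<open>D > 0\<close> by (simp add: pos_le_divide_eq)
  moreover have "d * (2 * D + d) \<le> d * (2 * D + 1)"
    using d by (intro mult_left_mono) auto
  ultimately have small: "d * (2 * D + d) + r \<le> e"
    using r by linarith
  show thesis
  proof (rule that[OF \<open>0 < d\<close>])
    fix L c assume KL: "dist K L < d" and c: "c \<in> body_set K \<union> body_set L"
    have KL1: "dist K L < 1" and KL0: "dist K L < d0"
      using KL d by auto
    have near: "\<exists>z'\<in>body_set K. dist z z' < 1" if "z \<in> body_set K \<union> body_set L" for z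
      using that
    proof
      assume "z \<in> body_set L"
      with KL1 show ?thesis
        by (metis body_near_point dist_commute)
    qed (auto intro!: bexI[of _ z])
    have D: "dist x c \<le> D" if x: "x \<in> body_set K \<union> body_set L" for x
    proof -
      obtain x' c' where "x' \<in> body_set K" "c' \<in> body_set K" "dist x x' < 1" "dist c c' < 1"
        using near[OF x] near[OF c] by blast
      then show ?thesis
        using dist_le_diameter_body[of x' K c'] dist_triangle[of x c x'] dist_triangle[of x' c c']
        unfolding D_def by (simp add: dist_commute)
    qed
    have "weighted_sqdist (body_set K) (f K) c \<le>
      weighted_sqdist (body_set L) (f L) c + d * (2 * D + d) + r"
    proof (rule weighted_sqdist_perturb)
      fix x assume x: "x \<in> body_set K"
      with KL obtain y where y: "y \<in> body_set L" "dist x y < d"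
        by (rule body_near_point)
      have "\<bar>f K x - f L y\<bar> < r"
        using d0(2)[OF KL0 x y(1)] y(2) d by simp
      then show "\<exists>y\<in>body_set L. dist x c \<le> dist y c + d \<and> dist y c \<le> D \<and> f K x \<le> f L y + r"
        using y D[of y] dist_triangle[of x c y] by (intro bexI[of _ y]) auto
    qed (use d body_set_nonempty compact_body_set continuous_on_weight in auto)
    moreover have "weighted_sqdist (body_set L) (f L) c \<le>
      weighted_sqdist (body_set K) (f K) c + d * (2 * D + d) + r"
    proof (rule weighted_sqdist_perturb)
      fix y assume y: "y \<in> body_set L"
      with KL obtain x where x: "x \<in> body_set K" "dist y x < d"
        using body_near_point[of L K d y] by (auto simp: dist_commute)
      have "\<bar>f K x - f L y\<bar> < r"
        using d0(2)[OF KL0 x(1) y] x(2) d by (simp add: dist_commute)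
      then show "\<exists>x\<in>body_set K. dist y c \<le> dist x c + d \<and> dist x c \<le> D \<and> f L y \<le> f K x + r"
        using x D[of x] dist_triangle[of y c x] by (intro bexI[of _ x]) auto
    qed (use d body_set_nonempty compact_body_set continuous_on_weight in auto)
    ultimately show "\<bar>weighted_sqdist (body_set K) (f K) c - weighted_sqdist (body_set L) (f L) c\<bar> \<le> e"
      using small by linarith
  qed
qed

text \<open>The centre of \<open>L\<close> nearly minimises the functional of \<open>K\<close>:
  passing from \<open>K\<close> to \<open>L\<close> and back costs \<open>r\<close> each time, and
  the gap estimate doubles this to \<open>4 * r\<close>, which is half of the square of
  \<open>e\<close>.\<close>

lemma continuous_on_center: "continuous_on UNIV center"
  unfolding continuous_on_iff
proof (intro ballI allI impI)
  fix K :: "'n convex_body" and e :: real assume "0 < e"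
  let ?F = "\<lambda>K. weighted_sqdist (body_set K) (f K)"
  define r where "r = e\<^sup>2 / 8"
  have r: "0 < r" "e\<^sup>2 = 8 * r"
    using \<open>0 < e\<close> by (simp_all add: r_def)
  obtain d where d: "0 < d" "\<And>L c. dist K L < d \<Longrightarrow> c \<in> body_set K \<union> body_set L \<Longrightarrow>
      \<bar>?F K c - ?F L c\<bar> \<le> r"
    using weighted_sqdist_body_close[OF r(1), of K] by blast
  have "dist (center L) (center K) < e" if "dist L K < d" for L
  proof (rule power_less_imp_less_base)
    have KL: "dist K L < d"
      using that by (simp add: dist_commute)
    have "(dist (center L) (center K))\<^sup>2 \<le> 2 * (?F K (center L) - ?F K (center K))"
      by (intro weighted_sqdist_gap compact_body_set body_set_nonempty continuous_on_weight center_le)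
    moreover have "\<bar>?F K (center L) - ?F L (center L)\<bar> \<le> r"
      "\<bar>?F K (center K) - ?F L (center K)\<bar> \<le> r"
      using d(2)[OF KL] center_in by auto
    moreover have "?F L (center L) \<le> ?F L (center K)"
      by (rule center_le)
    ultimately have "(dist (center L) (center K))\<^sup>2 \<le> 4 * r"
      by argo
    also have "\<dots> < e\<^sup>2"
      using r by simp
    finally show "(dist (center L) (center K))\<^sup>2 < e\<^sup>2" .
  qed (use \<open>0 < e\<close> in simp)
  with d(1) show "\<exists>d>0. \<forall>L\<in>UNIV. dist L K < d \<longrightarrow> dist (center L) (center K) < e"
    by blast
qed

text \<open>The functional of the image body is a constant multiple of the original one. Since
  \<open>A\<close> is surjective, every competitor is some \<open>A d'\<close>, so
  \<open>A (center K)\<close> is a minimiser, and minimisers are unique.\<close>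

lemma center_image:
  assumes A: "A \<in> similarities"
  shows "center (image_body A K) = A (center K)"
proof -
  obtain s where s: "s > 0" "\<And>x y. dist (A x) (A y) = s * dist x y"
    using similarity_dist[OF A] by blast
  let ?F = "\<lambda>K. weighted_sqdist (body_set K) (f K)"
  have F: "?F (image_body A K) (A c) = s\<^sup>2 * ?F K c" for c
    unfolding body_set_image_body[OF A]
    using compact_body_set[of "image_body A K"] continuous_on_weight[of "image_body A K"]
    by (intro weighted_sqdist_image compact_body_set body_set_nonempty continuous_on_weight s
        weight_image[OF A]) (auto simp: body_set_image_body[OF A])
  have "?F (image_body A K) (A (center K)) \<le> ?F (image_body A K) d" for d
  proof -
    obtain d' where "d = A d'"
      using similarity_affine_bij[OF A] by (metis bij_pointE)
    then show ?thesis
      by (simp add: F mult_left_mono center_le)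
  qed
  then show ?thesis
    unfolding center_def[of "image_body A K"]
    by (intro weighted_center_eqI compact_body_set body_set_nonempty continuous_on_weight)
qed

lemma center_invariant_point: "center \<in> similarity_invariant_points_of_body"
  unfolding similarity_invariant_points_of_body_def
  using continuous_on_center center_image center_in by blast

end

section \<open>The two weights in use, and combinations of invariant points\<close>

interpretation chebyshev: similarity_weight "\<lambda>K x. 0"
  by unfold_locales (auto intro: exI[of _ 1])

text \<open>\<open>r\<close> is unrestricted: the reflection of \<open>x\<close> in \<open>y\<close>
  is the case \<open>r = 2\<close>, convex combinations have \<open>r\<close> between 0 and
  1.\<close>

lemma similarity_affine_combination:
  assumes "A \<in> similarities"
  shows "A (x + r *\<^sub>R (y - x)) = A x + r *\<^sub>R (A y - A x)"
proof -
  obtain f b where "linear f" "A = (\<lambda>x. f x + b)"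
    using similarity_affine_bij[OF assms] by blast
  then show ?thesis
    by (simp add: linear_add linear_diff linear_cmul)
qed

text \<open>The weight measures the asymmetry of \<open>K\<close> about \<open>p K\<close>: it
  vanishes on \<open>K\<close> exactly when \<open>K\<close> contains its reflection. Continuity
  follows from a^2 - b^2 = (a - b) (a + b), invariance from similarities being affine.\<close>

lemma similarity_weight_reflection:
  assumes p: "p \<in> similarity_invariant_points_of_body"
  shows "similarity_weight (\<lambda>K x. (infdist (2 *\<^sub>R p K - x) (body_set K))\<^sup>2)"
proof
  fix e :: real and K :: "'a convex_body" assume "0 < e"
  have pK: "p K \<in> body_set K" for K
    using p by (simp add: similarity_invariant_points_of_body_def)
  define D where "D = diameter (body_set K)"
  have "D > 0"
    using diameter_body_pos[of K] by (simp add: D_def)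
  \<comment> \<open>\<open>2 * D + 2\<close> will dominate the sum of the two distances, so
    distances differing by less than \<open>h\<close> have squares differing by less than
    \<open>e\<close>.\<close>
  define h where "h = min 1 (e / (2 * D + 2))"
  have h: "0 < h" "h \<le> 1"
    using \<open>0 < e\<close> \<open>D > 0\<close> by (auto simp: h_def)
  have "h \<le> e / (2 * D + 2)"
    by (simp add: h_def)
  then have he: "h * (2 * D + 2) \<le> e"
    using \<open>D > 0\<close> by (simp add: pos_le_divide_eq)
  have "h / 4 > 0"
    using h by simp
  with p obtain d0 where d0: "d0 > 0" "\<And>L. dist L K < d0 \<Longrightarrow> dist (p L) (p K) < h / 4"
    unfolding similarity_invariant_points_of_body_def continuous_on_iff by blast
  \<comment> \<open>The reflected points differ by at most twice the shift of \<open>p\<close> plus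
    the shift of \<open>x\<close>; with the distance of the bodies this makes four quarters of
    \<open>h\<close>.\<close>
  define d where "d = min d0 (h / 4)"
  have "\<bar>(infdist (2 *\<^sub>R p K - x) (body_set K))\<^sup>2 - (infdist (2 *\<^sub>R p L - y) (body_set L))\<^sup>2\<bar> < e"
    if KL: "dist K L < d" and x: "x \<in> body_set K" and y: "y \<in> body_set L" and xy: "dist x y < d" for L x y
  proof -
    let ?a = "infdist (2 *\<^sub>R p K - x) (body_set K)" and ?b = "infdist (2 *\<^sub>R p L - y) (body_set L)"
    have "dist (2 *\<^sub>R p K - x) (2 *\<^sub>R p L - y) \<le> 2 * dist (p K) (p L) + dist x y"
    proof -
      have eq: "2 *\<^sub>R p K - x - (2 *\<^sub>R p L - y) = 2 *\<^sub>R (p K - p L) - (x - y)"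
        by (simp add: algebra_simps)
      show ?thesis
        unfolding dist_norm eq using norm_triangle_ineq4[of "2 *\<^sub>R (p K - p L)" "x - y"] by simp
    qed
    moreover have "dist (p K) (p L) < h / 4"
      using d0(2)[of L] KL by (simp add: d_def dist_commute)
    moreover have "dist K L < h / 4" "dist x y < h / 4"
      using KL xy by (auto simp: d_def)
    moreover note infdist_body_le[of "2 *\<^sub>R p K - x" K "2 *\<^sub>R p L - y" L]
      infdist_body_le[of "2 *\<^sub>R p L - y" L "2 *\<^sub>R p K - x" K]
    ultimately have ab: "\<bar>?a - ?b\<bar> < h"
      by (simp add: abs_less_iff dist_commute)
    have "?a \<le> dist (2 *\<^sub>R p K - x) (p K)"
      by (intro infdist_le pK)
    also have "\<dots> = dist (p K) x"
      by (simp add: dist_norm scaleR_2)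
    also have "\<dots> \<le> D"
      unfolding D_def by (intro dist_le_diameter_body pK x)
    finally have "?a \<le> D" .
    then have "?a + ?b < 2 * D + 2"
      using ab h by linarith
    have "\<bar>?a\<^sup>2 - ?b\<^sup>2\<bar> = \<bar>?a - ?b\<bar> * (?a + ?b)"
      using infdist_nonneg[of "2 *\<^sub>R p K - x" "body_set K"] infdist_nonneg[of "2 *\<^sub>R p L - y" "body_set L"]
      by (simp add: power2_eq_square square_diff_square_factored abs_mult)
    also have "\<dots> \<le> h * (?a + ?b)"
      using ab by (intro mult_right_mono) (auto intro: add_nonneg_nonneg infdist_nonneg)
    also have "\<dots> < h * (2 * D + 2)"
      using \<open>?a + ?b < 2 * D + 2\<close> h by (intro mult_strict_left_mono) auto
    finally show ?thesis
      using he by linarith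
  qed
  moreover have "d > 0"
    using d0 h by (simp add: d_def)
  ultimately show "\<exists>d>0. \<forall>L x y. dist K L < d \<longrightarrow> x \<in> body_set K \<longrightarrow> y \<in> body_set L \<longrightarrow> dist x y < d \<longrightarrow>
      \<bar>(infdist (2 *\<^sub>R p K - x) (body_set K))\<^sup>2 - (infdist (2 *\<^sub>R p L - y) (body_set L))\<^sup>2\<bar> < e"
    by blast
next
  fix A :: "real ^ 'a \<Rightarrow> real ^ 'a" and s K x
  assume A: "A \<in> similarities" "s > 0" "\<And>x y. dist (A x) (A y) = s * dist x y"
  have "p (image_body A K) = A (p K)"
    using p A(1) by (simp add: similarity_invariant_points_of_body_def)
  moreover have "2 *\<^sub>R A (p K) - A x = A (2 *\<^sub>R p K - x)"
    using similarity_affine_combination[OF A(1), of "x" 2 "p K"]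
    by (simp add: algebra_simps scaleR_2)
  ultimately show "(infdist (2 *\<^sub>R p (image_body A K) - A x) (body_set (image_body A K)))\<^sup>2 =
      s\<^sup>2 * (infdist (2 *\<^sub>R p K - x) (body_set K))\<^sup>2"
    by (simp add: infdist_image_body[OF A] power_mult_distrib)
qed

text \<open>The coefficient may vary with the body as long as it is similarity-invariant. This is
  the source of infinitely many invariant points from just two.\<close>

lemma invariant_point_combination:
  assumes p: "p \<in> similarity_invariant_points_of_body"
    and q: "q \<in> similarity_invariant_points_of_body"
    and w: "continuous_on UNIV w" "\<And>K. w K \<in> {0..1}"
      "\<And>A K. A \<in> similarities \<Longrightarrow> w (image_body A K) = w K"
  shows "(\<lambda>K. p K + w K *\<^sub>R (q K - p K)) \<in> similarity_invariant_points_of_body"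
  unfolding similarity_invariant_points_of_body_def
proof (intro CollectI conjI allI ballI)
  show "continuous_on UNIV (\<lambda>K. p K + w K *\<^sub>R (q K - p K))"
    using p q w(1) unfolding similarity_invariant_points_of_body_def
    by (intro continuous_intros) auto
  fix K
  have "p K \<in> body_set K" "q K \<in> body_set K"
    using p q by (auto simp: similarity_invariant_points_of_body_def)
  then have "(1 - w K) *\<^sub>R p K + w K *\<^sub>R q K \<in> body_set K"
    using w(2)[of K] by (intro convexD_alt convex_body_set) auto
  then show "p K + w K *\<^sub>R (q K - p K) \<in> body_set K"
    by (simp add: algebra_simps)
  show "p (image_body A K) + w (image_body A K) *\<^sub>R (q (image_body A K) - p (image_body A K)) =
      A (p K + w K *\<^sub>R (q K - p K))" if "A \<in> similarities" for A
    using p q that similarity_affine_combination[OF that] w(3)[OF that]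
    by (simp add: similarity_invariant_points_of_body_def)
qed

section \<open>Linear independence of the powers of a function\<close>

lemma sum_apply_fun: "(\<Sum>i\<in>T. g i) x = (\<Sum>i\<in>T. (g i x :: 'b :: comm_monoid_add))"
  by (induction T rule: infinite_finite_induct) (auto simp: zero_fun_def)

text \<open>A linear relation among these functions is a polynomial vanishing at every value of
  \<open>w\<close> taken where \<open>v\<close> is non-zero, hence at infinitely many points. So the
  family is independent, and it is too large for a finite span.\<close>

lemma powers_scaleR_not_in_finite_span:
  fixes w :: "'a \<Rightarrow> real" and v :: "'a \<Rightarrow> 'b::real_vector"
  assumes inf: "infinite (w ` {x. v x \<noteq> 0})" and P: "finite P"
  shows "\<exists>k::nat. (\<lambda>x. w x ^ k *\<^sub>R v x) \<notin> span P"
proof (rule ccontr)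
  define g where "g = (\<lambda>(k::nat) x. w x ^ k *\<^sub>R v x)"
  have coeffs: "\<forall>k\<in>T. a k = 0" if T: "finite T" and 0: "(\<Sum>k\<in>T. a k *\<^sub>R g k) = 0" for a T
  proof -
    define Q where "Q = (\<Sum>k\<in>T. monom (a k) k)"
    have "poly Q (w x) = 0" if "v x \<noteq> 0" for x
    proof -
      have "poly Q (w x) *\<^sub>R v x = (\<Sum>k\<in>T. a k *\<^sub>R g k) x"
        by (simp add: Q_def poly_sum poly_monom sum_apply_fun g_def scaleR_sum_left)
      with 0 that show ?thesis
        by (simp add: zero_fun_def)
    qed
    then have "w ` {x. v x \<noteq> 0} \<subseteq> {r. poly Q r = 0}"
      by auto
    with inf have "Q = 0"
      using poly_roots_finite finite_subset by blast
    moreover have "coeff Q k = a k" if "k \<in> T" for k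
      using T that by (simp add: Q_def coeff_sum)
    ultimately show ?thesis
      by simp
  qed
  \<comment> \<open>Injectivity lets relations over subsets of \<open>range g\<close> be reindexed
    by exponents, and makes \<open>range g\<close> infinite.\<close>
  have "inj g"
  proof (rule injI, rule ccontr)
    fix i j assume "g i = g j" "i \<noteq> j"
    then have "(\<Sum>k\<in>{i, j}. (if k = i then 1 else - 1) *\<^sub>R g k) = 0"
      by simp
    from coeffs[OF _ this] show False
      by auto
  qed
  have "independent (range g)"
    unfolding dependent_explicit
  proof (intro notI, elim exE conjE bexE)
    fix T u y
    assume T: "finite T" "T \<subseteq> range g" "(\<Sum>y\<in>T. u y *\<^sub>R y) = 0" and y: "y \<in> T" "u y \<noteq> 0"
    obtain I where I: "finite I" "T = g ` I"
      using finite_subset_image[OF T(1,2)] by blast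
    have "(\<Sum>k\<in>I. u (g k) *\<^sub>R g k) = 0"
      using T(3) unfolding I(2) by (subst (asm) sum.reindex) (auto intro: inj_on_subset[OF \<open>inj g\<close>])
    from coeffs[OF I(1) this] show False
      using y I(2) by blast
  qed
  moreover assume "\<nexists>k. (\<lambda>x. w x ^ k *\<^sub>R v x) \<notin> span P"
  then have "range g \<subseteq> span P"
    by (auto simp: g_def)
  ultimately have "finite (range g)"
    using independent_span_bound[OF P] by blast
  with \<open>inj g\<close> show False
    using finite_imageD by blast
qed

section \<open>Caps of the unit ball\<close>

text \<open>For a unit vector \<open>e\<close> the caps grow from a half-ball at
  \<open>h = 0\<close> to the whole ball at \<open>h = 1\<close>.\<close>

definition ball_cap :: "'a::real_inner \<Rightarrow> real \<Rightarrow> 'a set"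
  where "ball_cap e h = cball 0 1 \<inter> {x. x \<bullet> e \<le> h}"

lemma ball_cap_is_body:
  fixes e :: "'a::euclidean_space"
  assumes "norm e = 1" "0 \<le> h"
  shows "compact (ball_cap e h)" "convex (ball_cap e h)" "interior (ball_cap e h) \<noteq> {}"
proof -
  show "compact (ball_cap e h)"
    unfolding ball_cap_def by (intro compact_Int_closed compact_cball)
      (simp add: closed_halfspace_le inner_commute[of _ e])
  show "convex (ball_cap e h)"
    unfolding ball_cap_def by (intro convex_Int convex_cball)
      (simp add: convex_halfspace_le inner_commute[of _ e])
  \<comment> \<open>The ball inscribed between the pole \<open>- e\<close> and the origin lies in
    the half-ball, hence in every cap considered.\<close>
  have "ball (- (1/2) *\<^sub>R e) (1/2) \<subseteq> ball_cap e h"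
  proof
    fix x assume x: "x \<in> ball (- (1/2) *\<^sub>R e) (1/2)"
    then have n: "norm (x + (1/2) *\<^sub>R e) < 1/2"
      by (simp add: dist_norm norm_minus_commute add.commute)
    have "norm x \<le> norm (x + (1/2) *\<^sub>R e) + norm ((1/2) *\<^sub>R e)"
      using norm_triangle_ineq4[of "x + (1/2) *\<^sub>R e" "(1/2) *\<^sub>R e"] by simp
    with n assms have "norm x \<le> 1" by simp
    moreover have "(x + (1/2) *\<^sub>R e) \<bullet> e \<le> norm (x + (1/2) *\<^sub>R e) * norm e"
      by (rule norm_cauchy_schwarz)
    then have "x \<bullet> e \<le> 0"
      using n assms by (simp add: inner_add_left power2_norm_eq_inner[symmetric])
    ultimately show "x \<in> ball_cap e h"
      using assms by (simp add: ball_cap_def)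
  qed
  then show "interior (ball_cap e h) \<noteq> {}"
    by (metis interior_maximal open_ball centre_in_ball empty_iff subset_iff half_gt_zero zero_less_one)
qed

lemma near_ball_cap:
  fixes e :: "'a::real_inner"
  assumes "norm e = 1" "0 \<le> h" "norm x \<le> 1"
  shows "\<exists>y\<in>ball_cap e h. dist x y \<le> max 0 (x \<bullet> e - h)"
proof -
  \<comment> \<open>The projection to the half-space is \<open>x - t *\<^sub>R e\<close>; it stays in the ball because \<open>h \<ge> 0\<close>.\<close>
  define t where "t = max 0 (x \<bullet> e - h)"
  have ee: "e \<bullet> e = 1"
    using assms(1) by (simp add: norm_eq_1)
  have "(norm (x - t *\<^sub>R e))\<^sup>2 = (norm x)\<^sup>2 - t * (2 * (x \<bullet> e) - t)"
    unfolding power2_norm_eq_inner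
    by (simp add: inner_diff_left inner_diff_right ee inner_commute algebra_simps)
  moreover have "t * (2 * (x \<bullet> e) - t) \<ge> 0"
    using assms(2) by (auto simp: t_def max_def)
  moreover have "(norm x)\<^sup>2 \<le> 1"
    using assms(3) by (simp add: power_le_one)
  ultimately have "(norm (x - t *\<^sub>R e))\<^sup>2 \<le> 1"
    by linarith
  then have "norm (x - t *\<^sub>R e) \<le> 1"
    using power2_le_imp_le[of _ 1] by simp
  moreover have "(x - t *\<^sub>R e) \<bullet> e \<le> h"
    by (simp add: inner_diff_left ee t_def)
  ultimately show ?thesis
    using assms(1) by (intro bexI[of _ "x - t *\<^sub>R e"]) (auto simp: ball_cap_def dist_norm norm_minus_commute t_def)
qed

section \<open>The caps as a continuous path of convex bodies\<close>

definition cap_body :: "real ^ 'n \<Rightarrow> real \<Rightarrow> 'n::finite convex_body"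
  where "cap_body e h = Body (ball_cap e h)"

lemma body_set_cap_body:
  "norm e = 1 \<Longrightarrow> 0 \<le> h \<Longrightarrow> body_set (cap_body e h) = ball_cap e h"
  by (simp add: cap_body_def Body_inverse ball_cap_is_body)

text \<open>The caps are nested, so only points of the larger cap have to be moved;
  \<open>near_ball_cap\<close> bounds how far.\<close>

lemma dist_cap_body_le:
  assumes "norm e = 1" "0 \<le> h" "h \<le> h'"
  shows "dist (cap_body e h) (cap_body e h') \<le> h' - h"
proof (rule dist_convex_body_le)
  have b: "body_set (cap_body e h) = ball_cap e h" "body_set (cap_body e h') = ball_cap e h'"
    using assms by (simp_all add: body_set_cap_body)
  show "\<exists>y\<in>body_set (cap_body e h'). dist x y \<le> h' - h" if "x \<in> body_set (cap_body e h)" for x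
    using that assms unfolding b by (intro bexI[of _ x]) (auto simp: ball_cap_def)
  show "\<exists>x\<in>body_set (cap_body e h). dist x y \<le> h' - h" if y: "y \<in> body_set (cap_body e h')" for y
  proof -
    from y have "norm y \<le> 1" "y \<bullet> e \<le> h'"
      unfolding b by (auto simp: ball_cap_def)
    with near_ball_cap[OF assms(1,2), of y] assms(3) show ?thesis
      unfolding b by (force simp: dist_commute)
  qed
qed

lemma continuous_on_cap_body:
  assumes "norm e = 1"
  shows "continuous_on {0..1} (cap_body e)"
proof (rule lipschitz_on_continuous_on)
  show "1-lipschitz_on {0..1} (cap_body e)"
  proof (rule lipschitz_onI)
    fix h h' :: real assume "h \<in> {0..1}" "h' \<in> {0..1}"
    then show "dist (cap_body e h) (cap_body e h') \<le> 1 * dist h h'"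
      using dist_cap_body_le[OF assms, of h h'] dist_cap_body_le[OF assms, of h' h]
      by (cases "h \<le> h'") (auto simp: dist_real_def dist_commute)
  qed simp
qed

text \<open>The cap at height 1 is the full ball, which is mapped to itself by the similarity
  \<open>uminus\<close>; the origin is the only fixed point of that map.\<close>

lemma invariant_point_unit_ball:
  assumes p: "p \<in> similarity_invariant_points_of_body" and "norm e = 1"
  shows "p (cap_body e 1) = 0"
proof -
  have "x \<bullet> e \<le> 1" if "norm x \<le> 1" for x
    using norm_cauchy_schwarz[of x e] that assms(2) by simp
  then have b: "body_set (cap_body e 1) = cball 0 1"
    using assms(2) by (auto simp: body_set_cap_body ball_cap_def)
  have "bij (uminus :: real ^ 'a \<Rightarrow> _)"
    by (rule o_bij[of uminus]) (auto simp: fun_eq_iff)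
  then have A: "(uminus :: real ^ 'a \<Rightarrow> _) \<in> similarities"
    unfolding similarities_def
    by (intro generate.incl) (auto simp: orthogonality_preserving_maps_def orthogonal_def
        intro!: linear_uminus)
  have "image_body uminus (cap_body e 1) = cap_body e 1"
    unfolding body_set_inject[symmetric] body_set_image_body[OF A] b
    by (auto intro: image_eqI[of _ uminus, OF minus_minus[symmetric]])
  then have "p (cap_body e 1) = - p (cap_body e 1)"
    using p A by (metis (mono_tags, lifting) mem_Collect_eq similarity_invariant_points_of_body_def)
  then show ?thesis
    by (simp add: vec_eq_iff)
qed

text \<open>The antipodal points \<open>u\<close> and \<open>- u\<close> of the flat face force the
  functional at \<open>c\<close> to be at least 1 + |c|^2, while at the origin it is at most 1. The
  choice of \<open>u\<close> is where dimension at least 2 enters.\<close>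

lemma chebyshev_center_half_ball:
  fixes e u :: "real ^ 'n::finite"
  assumes e: "norm e = 1" and u: "norm u = 1" "u \<bullet> e = 0"
  shows "chebyshev.center (cap_body e 0) = 0"
proof -
  let ?K = "ball_cap e 0"
  have b: "body_set (cap_body e 0) = ?K"
    using e by (simp add: body_set_cap_body)
  have cpt: "compact ?K" "?K \<noteq> {}"
    using compact_body_set[of "cap_body e 0"] body_set_nonempty[of "cap_body e 0"] by (simp_all add: b)
  define c where "c = chebyshev.center (cap_body e 0)"
  have up: "(dist x c)\<^sup>2 \<le> weighted_sqdist ?K (\<lambda>x. 0) c" if "x \<in> ?K" for x
    using weighted_sqdist_upper[OF cpt(1) _ that, of "\<lambda>x. 0" c] by simp
  have "u \<in> ?K" "- u \<in> ?K"
    using u by (auto simp: ball_cap_def)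
  then have "(dist u c)\<^sup>2 + (dist (- u) c)\<^sup>2 \<le> 2 * weighted_sqdist ?K (\<lambda>x. 0) c"
    using up[of u] up[of "- u"] by simp
  moreover have "(dist u c)\<^sup>2 + (dist (- u) c)\<^sup>2 = 2 + 2 * (c \<bullet> c)"
    using u(1) unfolding dist_norm power2_norm_eq_inner
    by (simp add: inner_simps inner_commute norm_eq_1)
  moreover have "weighted_sqdist ?K (\<lambda>x. 0) c \<le> weighted_sqdist ?K (\<lambda>x. 0) 0"
    using chebyshev.center_le[of "cap_body e 0" 0] by (simp add: b c_def)
  moreover have "weighted_sqdist ?K (\<lambda>x. 0) 0 \<le> 1"
    by (intro weighted_sqdist_least cpt) (auto simp: ball_cap_def power_le_one)
  ultimately have "c \<bullet> c \<le> 0"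
    by linarith
  then have "c = 0"
    by (metis antisym inner_eq_zero_iff inner_ge_zero)
  then show ?thesis
    by (simp only: c_def)
qed

text \<open>At the origin the pole \<open>- e\<close> alone contributes 2, since its reflection
  \<open>e\<close> has distance 1 from the half-ball. At \<open>- (1/2) *\<^sub>R e\<close> the
  functional is at most 5/4, so the origin is no minimiser.\<close>

lemma reflection_center_half_ball:
  fixes e :: "real ^ 'n::finite"
  assumes e: "norm e = 1" and p: "p \<in> similarity_invariant_points_of_body" "p (cap_body e 0) = 0"
  shows "similarity_weight.center (\<lambda>K x. (infdist (2 *\<^sub>R p K - x) (body_set K))\<^sup>2) (cap_body e 0) \<noteq> 0"
proof
  interpret similarity_weight "\<lambda>K x. (infdist (2 *\<^sub>R p K - x) (body_set K))\<^sup>2"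
    using p(1) by (rule similarity_weight_reflection)
  let ?K = "ball_cap e 0" and ?f = "\<lambda>x. (infdist (- x) (ball_cap e 0))\<^sup>2"
  assume 0: "center (cap_body e 0) = 0"
  have b: "body_set (cap_body e 0) = ?K"
    using e by (simp add: body_set_cap_body)
  have cpt: "compact ?K" "?K \<noteq> {}"
    using compact_body_set[of "cap_body e 0"] body_set_nonempty[of "cap_body e 0"] by (simp_all add: b)
  have ee: "e \<bullet> e = 1"
    using e by (simp add: norm_eq_1)
  have "- e \<in> ?K"
    using e ee by (simp add: ball_cap_def)
  then have "(dist (- e) 0)\<^sup>2 + ?f (- e) \<le> weighted_sqdist ?K ?f 0"
    by (intro weighted_sqdist_upper cpt continuous_intros)
  moreover have "1 \<le> infdist e ?K"
    unfolding infdist_notempty[OF cpt(2)]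
  proof (rule cINF_greatest[OF cpt(2)])
    fix y assume "y \<in> ?K"
    then have "1 \<le> (e - y) \<bullet> e"
      by (simp add: ball_cap_def inner_diff_left ee)
    also have "\<dots> \<le> dist e y"
      using norm_cauchy_schwarz[of "e - y" e] e by (simp add: dist_norm)
    finally show "1 \<le> dist e y" .
  qed
  then have "1 \<le> ?f (- e)"
    by (simp add: one_le_power)
  ultimately have "2 \<le> weighted_sqdist ?K ?f 0"
    using e by simp
  also have "\<dots> \<le> weighted_sqdist ?K ?f (- (1/2) *\<^sub>R e)"
    using center_le[of "cap_body e 0" "- (1/2) *\<^sub>R e"] by (simp add: 0 b p(2))
  also have "\<dots> \<le> 5/4"
  proof (rule weighted_sqdist_least[OF cpt(2)])
    fix x assume "x \<in> ?K"
    then have x: "norm x \<le> 1" "x \<bullet> e \<le> 0"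
      by (auto simp: ball_cap_def)
    \<comment> \<open>The depth of \<open>x\<close> below the flat face. The reflected point
      overshoots the half-ball by at most \<open>s\<close>, and the resulting weight, at most
      \<open>s\<close>, is cancelled by the gain \<open>- s\<close> from shifting the
      centre.\<close>
    define s where "s = - (x \<bullet> e)"
    have s: "0 \<le> s" "s \<le> 1"
      using x norm_cauchy_schwarz[of "- x" e] e by (simp_all add: s_def)
    have "infdist (- x) ?K \<le> s"
      using near_ball_cap[OF e, of 0 "- x"] x(1) s(1) infdist_le2 by (fastforce simp: s_def)
    then have "?f x \<le> s\<^sup>2"
      by (intro power_mono) (auto simp: infdist_nonneg)
    also have "\<dots> \<le> s"
      using s by (simp add: power2_eq_square mult_left_le)
    finally have "?f x \<le> s" .
    moreover have "(dist x (- (1/2) *\<^sub>R e))\<^sup>2 = (norm x)\<^sup>2 - s + 1/4"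
      unfolding dist_norm power2_norm_eq_inner
      by (simp add: inner_simps inner_commute ee s_def)
    moreover have "(norm x)\<^sup>2 \<le> 1"
      using x(1) by (simp add: power_le_one)
    ultimately show "(dist x (- (1/2) *\<^sub>R e))\<^sup>2 + ?f x \<le> 5/4"
      by simp
  qed
  finally show False by simp
qed

section \<open>No finite set spans all invariant points\<close>

theorem theorem5:
  assumes "CARD('n::finite) \<ge> 2"
  shows "\<not> (\<exists>(m::nat) (p :: nat \<Rightarrow> 'n convex_body \<Rightarrow> real ^ 'n).
    m \<ge> 1 \<and>
    (\<forall>i\<in>{1..m}. p i \<in> similarity_invariant_points_of_body) \<and>
    similarity_invariant_points_of_body = convex hull (p ` {1..m}))"
proof
  let ?S = "similarity_invariant_points_of_body :: ('n convex_body \<Rightarrow> real ^ 'n) set"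
  assume "\<exists>(m::nat) (p :: nat \<Rightarrow> 'n convex_body \<Rightarrow> real ^ 'n).
    m \<ge> 1 \<and> (\<forall>i\<in>{1..m}. p i \<in> ?S) \<and> ?S = convex hull (p ` {1..m})"
  then obtain P :: "('n convex_body \<Rightarrow> real ^ 'n) set" where P: "finite P" "?S = convex hull P"
    by blast
  obtain i j :: 'n where "i \<noteq> j"
    using assms by (metis card_2_iff' ex_card iso_tuple_UNIV_I)
  define e u :: "real ^ 'n" where "e = axis i 1" and "u = axis j 1"
  have e: "norm e = 1" and u: "norm u = 1" "u \<bullet> e = 0"
    using \<open>i \<noteq> j\<close> by (simp_all add: e_def u_def inner_axis_axis)
  define p :: "'n convex_body \<Rightarrow> real ^ 'n" where "p = chebyshev.center"
  have p: "p \<in> ?S"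
    unfolding p_def by (rule chebyshev.center_invariant_point)
  interpret reflection: similarity_weight "\<lambda>K x. (infdist (2 *\<^sub>R p K - x) (body_set K))\<^sup>2"
    using p by (rule similarity_weight_reflection)
  define q where "q = reflection.center"
  have q: "q \<in> ?S"
    unfolding q_def by (rule reflection.center_invariant_point)
  \<comment> \<open>Dividing by the diameter removes the scale factor; the quotient is at most 1
    because both points lie in \<open>K\<close>.\<close>
  define w where "w K = dist (p K) (q K) / diameter (body_set K)" for K
  have "diameter (body_set K) \<noteq> 0" for K :: "'n convex_body"
    using diameter_body_pos[of K] by simp
  then have cont: "continuous_on UNIV w"
    unfolding w_def
    using p q
    by (intro continuous_intros continuous_on_diameter_body)
      (simp_all add: similarity_invariant_points_of_body_def)
  have range: "w K \<in> {0..1}" for K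
  proof -
    have "dist (p K) (q K) \<le> diameter (body_set K)"
      using p q by (intro dist_le_diameter_body) (auto simp: similarity_invariant_points_of_body_def)
    then show ?thesis
      using diameter_body_pos[of K] by (simp add: w_def)
  qed
  have inv: "w (image_body A K) = w K" if A: "A \<in> similarities" for A K
  proof -
    obtain s where s: "s > 0" "\<And>x y. dist (A x) (A y) = s * dist x y"
      using similarity_dist[OF A] by blast
    then show ?thesis
      using p q A by (simp add: w_def similarity_invariant_points_of_body_def diameter_image_body[OF A s])
  qed
  \<comment> \<open>Both \<open>p\<close> and the combination with coefficient
    \<open>w K ^ k\<close> are invariant points, hence in the convex hull and in the span; their
    difference is the function in question.\<close>
  have "(\<lambda>K. w K ^ k *\<^sub>R (q K - p K)) \<in> span P" for k
  proof -
    have "(\<lambda>K. p K + w K ^ k *\<^sub>R (q K - p K)) \<in> ?S"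
      using range by (intro invariant_point_combination p q continuous_intros cont)
        (auto simp: inv power_le_one)
    then have "(\<lambda>K. p K + w K ^ k *\<^sub>R (q K - p K)) \<in> span P" "p \<in> span P"
      using p P(2) convex_hull_subset_span by blast+
    from span_diff[OF this] show ?thesis
      by (simp add: fun_diff_def)
  qed
  moreover have "infinite (w ` {K. q K - p K \<noteq> 0})"
  proof -
    let ?w = "\<lambda>h. w (cap_body e h)"
    have "p (cap_body e 0) = 0"
      unfolding p_def using e u by (rule chebyshev_center_half_ball)
    with reflection_center_half_ball[OF e p] have "?w 0 > 0"
      using diameter_body_pos[of "cap_body e 0"] by (simp add: w_def q_def)
    have "continuous_on {0..1} ?w"
      using continuous_on_cap_body[OF e] by (intro continuous_on_compose2[OF cont]) auto
    then have "connected (?w ` {0..1})"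
      by (intro connected_continuous_image) auto
    moreover have "?w 1 = 0"
      using invariant_point_unit_ball[OF p e] invariant_point_unit_ball[OF q e] by (simp add: w_def)
    \<comment> \<open>Intermediate values along the path of caps, from the positive value at the
      half-ball down to 0 at the ball.\<close>
    ultimately have icc: "{0..?w 0} \<subseteq> ?w ` {0..1}"
      by (intro connected_contains_Icc) (auto intro: rev_image_eqI[of 1])
    \<comment> \<open>Zero is left out because a non-zero value of \<open>w\<close> is what
      guarantees that \<open>q\<close> and \<open>p\<close> differ at the cap found.\<close>
    have "{0<..?w 0} \<subseteq> w ` {K. q K - p K \<noteq> 0}"
    proof
      fix r assume "r \<in> {0<..?w 0}"
      then have "r \<in> {0..?w 0}" "r \<noteq> 0"
        by auto
      with icc obtain h where "r = ?w h" "r \<noteq> 0"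
        by blast
      then show "r \<in> w ` {K. q K - p K \<noteq> 0}"
        by (intro image_eqI[of _ w "cap_body e h"]) (auto simp: w_def)
    qed
    moreover have "infinite {0<..?w 0}"
      using \<open>?w 0 > 0\<close> by simp
    ultimately show ?thesis
      using finite_subset by blast
  qed
  ultimately show False
    using powers_scaleR_not_in_finite_span[where w = w and v = "\<lambda>K. q K - p K", OF _ P(1)] by blast
qed

end
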